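(* The system $$H(x_\rho)x_t=[\Phi'(x_\rho)]_\rho\quad\text{in } I\times(0,T]$$ is parabolic in the sense of Petrovsky; that is, writing it as $x_t=H^{-1}(x_\rho)\Phi''(x_\rho)x_{\rho\rho}$, for every $p\in\mathbb{R}^d\setminus\{0\}$ all (complex) eigenvalues of the matrix $H^{-1}(p)\Phi''(p)$ have positive real part.
   Context: Let $d\ge2$. The anisotropy $\phi\in C^0(\mathbb{R}^d,\mathbb{R}_{\ge0})\cap C^4(\mathbb{R}^d\setminus\{0\},\mathbb{R}_{>0})$ satisfies $\phi(\lambda p)=|\lambda|\phi(p)$ for all $p\in\mathbb{R}^d$, $\lambda\in\mathbb{R}$, and $\phi''(p)q\cdot q>0$ for all $p,q\in\mathbb{R}^d$ with $|p|=|q|=1$, $p\cdot q=0$; primes denote gradient and Hessian. $\Phi(p)=\tfrac12\phi^2(p)$. The mobility $\mathfrak{m}:\mathbb{S}^{d-1}\to\mathbb{R}_{>0}$ is extended $0$-homogeneously to $\mathbb{R}^d\setminus\{0\}$, with $\mathfrak{m}\in C^3(\mathbb{R}^d\setminus\{0\})$. For $p\in\mathbb{R}^d\setminus\{0\}$, $$H(p)=\alpha(p)\left[\mathrm{Id}+\frac{w(p)\otimes(\frac{p}{|p|}-w(p))-\frac{p}{|p|}\otimes(w(p)+|w(p)|^2\frac{p}{|p|})}{1+|w(p)|^2}\right],$$ with $\alpha(p)=\mathfrak{m}(p)|p|\phi(p)$ and $w(p)=\frac{|p|}{\phi(p)}\phi'(p)-\frac{p}{|p|}$, where $a\otimes b=ab^T$.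 The matrix $H(p)$ is invertible, with inverse denoted by $H^{-1}(p)$. $I=\mathbb{R}/\mathbb{Z}$, and subscripts $\rho,t$ denote partial derivatives. *)

theory Defs
  imports "HOL-Analysis.Analysis"
begin

text \<open>Class \<open>C\<^sup>k\<close>, meaningful for open \<open>S\<close>. Testing the derivative against every
  fixed direction \<open>v\<close> is equivalent to continuity of all partial derivatives up to order \<open>k\<close>.\<close>

fun Ck_on :: "nat \<Rightarrow> 'a set \<Rightarrow> ('a::euclidean_space \<Rightarrow> 'b::real_normed_vector) \<Rightarrow> bool" where
  "Ck_on 0 S f \<longleftrightarrow> continuous_on S f"
| "Ck_on (Suc k) S f \<longleftrightarrow>
     (\<forall>x\<in>S. f differentiable (at x)) \<and>
     (\<forall>v. Ck_on k S (\<lambda>x. frechet_derivative f (at x) v))"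

definition grad :: "(real^'n \<Rightarrow> real) \<Rightarrow> real^'n \<Rightarrow> real^'n" where
  "grad f p = (\<chi> i. frechet_derivative f (at p) (axis i 1))"

definition hessian :: "(real^'n \<Rightarrow> real) \<Rightarrow> real^'n \<Rightarrow> real^'n^'n" where
  "hessian f p = jacobian (grad f) (at p)"

definition outer :: "real^'n \<Rightarrow> real^'n \<Rightarrow> real^'n^'n"  (infix "\<otimes>\<^sub>o" 70) where
  "a \<otimes>\<^sub>o b = (\<chi> i j. a $ i * b $ j)"

definition anisotropy :: "(real^'n \<Rightarrow> real) \<Rightarrow> bool" where
  "anisotropy \<phi> \<longleftrightarrow>
     continuous_on UNIV \<phi> \<and> (\<forall>p. \<phi> p \<ge> 0) \<and>
     Ck_on 4 (- {0}) \<phi> \<and> (\<forall>p. p \<noteq> 0 \<longrightarrow> \<phi> p > 0) \<and>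
     (\<forall>p c. \<phi> (c *\<^sub>R p) = \<bar>c\<bar> * \<phi> p) \<and>
     (\<forall>p q. norm p = 1 \<and> norm q = 1 \<and> p \<bullet> q = 0 \<longrightarrow> (hessian \<phi> p *v q) \<bullet> q > 0)"

definition Phi :: "(real^'n \<Rightarrow> real) \<Rightarrow> real^'n \<Rightarrow> real" where
  "Phi \<phi> p = (\<phi> p)\<^sup>2 / 2"

text \<open>A mobility is a function on the unit sphere; only its values there matter.
  Recall \<open>sgn p = p /\<^sub>R norm p\<close>, so \<open>ext0 m\<close> is the \<open>0\<close>-homogeneous extension.\<close>

definition ext0 :: "(real^'n \<Rightarrow> real) \<Rightarrow> real^'n \<Rightarrow> real" where
  "ext0 m p = m (sgn p)"

definition mobility :: "(real^'n \<Rightarrow> real) \<Rightarrow> bool" where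
  "mobility m \<longleftrightarrow> (\<forall>p\<in>sphere 0 1. m p > 0) \<and> Ck_on 3 (- {0}) (ext0 m)"

definition alpha :: "(real^'n \<Rightarrow> real) \<Rightarrow> (real^'n \<Rightarrow> real) \<Rightarrow> real^'n \<Rightarrow> real" where
  "alpha \<phi> m p = ext0 m p * norm p * \<phi> p"

definition wvec :: "(real^'n \<Rightarrow> real) \<Rightarrow> real^'n \<Rightarrow> real^'n" where
  "wvec \<phi> p = (norm p / \<phi> p) *\<^sub>R grad \<phi> p - sgn p"

definition Hmat :: "(real^'n \<Rightarrow> real) \<Rightarrow> (real^'n \<Rightarrow> real) \<Rightarrow> real^'n \<Rightarrow> real^'n^'n" where
  "Hmat \<phi> m p =
     (let w = wvec \<phi> p; \<tau> = sgn p in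
      alpha \<phi> m p *\<^sub>R
        (mat 1 + (1 / (1 + (norm w)\<^sup>2)) *\<^sub>R
           (w \<otimes>\<^sub>o (\<tau> - w) - \<tau> \<otimes>\<^sub>o (w + (norm w)\<^sup>2 *\<^sub>R \<tau>))))"

text \<open>Families of curves are maps \<open>x \<rho> t\<close>, with \<open>\<real>/\<int>\<close> encoded by \<open>1\<close>-periodicity in \<open>\<rho>\<close>.
  The time derivative is taken within \<open>(0,T]\<close>, hence one-sided at \<open>t = T\<close>.\<close>

definition D_rho :: "(real \<Rightarrow> real \<Rightarrow> real^'n) \<Rightarrow> real \<Rightarrow> real \<Rightarrow> real^'n" where
  "D_rho x \<rho> t = vector_derivative (\<lambda>\<sigma>. x \<sigma> t) (at \<rho>)"

definition D_t :: "real \<Rightarrow> (real \<Rightarrow> real \<Rightarrow> real^'n) \<Rightarrow> real \<Rightarrow> real \<Rightarrow> real^'n" where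
  "D_t T x \<rho> t = vector_derivative (\<lambda>s. x \<rho> s) (at t within {0<..T})"

text \<open>The weakest pointwise regularity for which both forms of the system make sense;
  \<open>H\<close> is only defined away from \<open>0\<close>, so the curves have to be immersed.\<close>

definition regular_family :: "real \<Rightarrow> (real \<Rightarrow> real \<Rightarrow> real^'n) \<Rightarrow> bool" where
  "regular_family T x \<longleftrightarrow>
     (\<forall>t\<in>{0<..T}. \<forall>\<rho>.
        x (\<rho> + 1) t = x \<rho> t \<and>
        (\<lambda>s. x \<rho> s) differentiable (at t within {0<..T}) \<and>
        (\<lambda>\<sigma>. x \<sigma> t) differentiable (at \<rho>) \<and>
        (\<lambda>\<sigma>. D_rho x \<sigma> t) differentiable (at \<rho>) \<and>
        D_rho x \<rho> t \<noteq> 0)"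

definition flow_equation_at ::
  "(real^'n \<Rightarrow> real) \<Rightarrow> (real^'n \<Rightarrow> real) \<Rightarrow> real \<Rightarrow> (real \<Rightarrow> real \<Rightarrow> real^'n) \<Rightarrow> real \<Rightarrow> real \<Rightarrow> bool" where
  "flow_equation_at \<phi> m T x \<rho> t \<longleftrightarrow>
     Hmat \<phi> m (D_rho x \<rho> t) *v D_t T x \<rho> t =
     D_rho (\<lambda>\<sigma> s. grad (Phi \<phi>) (D_rho x \<sigma> s)) \<rho> t"

definition quasilinear_equation_at ::
  "(real^'n \<Rightarrow> real^'n^'n) \<Rightarrow> real \<Rightarrow> (real \<Rightarrow> real \<Rightarrow> real^'n) \<Rightarrow> real \<Rightarrow> real \<Rightarrow> bool" where
  "quasilinear_equation_at A T x \<rho> t \<longleftrightarrow>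
     D_t T x \<rho> t = A (D_rho x \<rho> t) *v D_rho (D_rho x) \<rho> t"

definition is_eigenvalue :: "complex^'n^'n \<Rightarrow> complex \<Rightarrow> bool" where
  "is_eigenvalue A \<mu> \<longleftrightarrow> (\<exists>v. v \<noteq> 0 \<and> A *v v = \<mu> *s v)"

text \<open>Petrovsky parabolicity of \<open>x\<^sub>t = A(x\<^sub>\<rho>) x\<^sub>\<rho>\<^sub>\<rho>\<close>, where \<open>A\<close> is only considered away from \<open>0\<close>.\<close>

definition petrovsky_parabolic :: "(real^'n \<Rightarrow> real^'n^'n) \<Rightarrow> bool" where
  "petrovsky_parabolic A \<longleftrightarrow>
     (\<forall>p. p \<noteq> 0 \<longrightarrow> (\<forall>\<mu>. is_eigenvalue (map_matrix complex_of_real (A p)) \<mu> \<longrightarrow> Re \<mu> > 0))"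

end

theory Submission
  imports Defs
begin

text \<open>Fix \<open>p \<noteq> 0\<close> and put \<open>\<tau> = p / |p|\<close>, \<open>H = H(p)\<close>, \<open>S = \<Phi>''(p)\<close>. The matrix \<open>H\<close> need not
  be symmetric, and \<open>H\<inverse>S\<close> may have non-real eigenvalues. It is enough, however, that \<open>H\<close> has
  positive definite symmetric part and that \<open>S\<close> is symmetric positive definite: if
  \<open>H\<inverse>S v = \<mu> v\<close> with complex \<open>v \<noteq> 0\<close>, then \<open>v\<^sup>*S v = \<mu> v\<^sup>*H v\<close>, where the left side is real
  and positive while \<open>v\<^sup>*H v\<close> has positive real part, so \<open>\<mu>\<close> has positive real part
  (\<open>eigenvalue_pos_real_part\<close>).

  Positivity of \<open>H\<close> (\<open>Hmat_pos\<close>) rests on Euler's identity \<open>\<phi>'(p) \<bullet> p = \<phi>(p)\<close>, which makes \<open>w\<close>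
  orthogonal to \<open>\<tau>\<close>. The mixed terms \<open>w \<otimes> \<tau> - \<tau> \<otimes> w\<close> are antisymmetric and drop out of the
  quadratic form, leaving
  \<open>H u \<bullet> u = \<alpha> (|u|\<^sup>2 - ((w \<bullet> u)\<^sup>2 + |w|\<^sup>2 (\<tau> \<bullet> u)\<^sup>2) / (1 + |w|\<^sup>2))\<close>. By Cauchy-Schwarz in the
  complement of \<open>\<tau>\<close> the numerator is at most \<open>|w|\<^sup>2 |u|\<^sup>2\<close>.

  For \<open>S = \<phi>' \<otimes> \<phi>' + \<phi> \<phi>''\<close> (\<open>hessian_Phi_pos\<close>), differentiating Euler's identity puts
  \<open>p\<close> in the kernel of \<open>\<phi>''(p)\<close>. The anisotropy hypothesis makes \<open>\<phi>''(p)\<close> positive on the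
  complement of \<open>p\<close>, and \<open>\<phi>' \<otimes> \<phi>'\<close> is positive in the direction \<open>p\<close>. Symmetry is the
  commutation of mixed second derivatives (\<open>mixed_derivatives_commute\<close>).

  The two forms of the system agree because of the chain rule
  \<open>[\<Phi>'(x\<^sub>\<rho>)]\<^sub>\<rho> = \<Phi>''(x\<^sub>\<rho>) x\<^sub>\<rho>\<^sub>\<rho>\<close> and the invertibility of \<open>H\<close>, which positivity also gives.\<close>

section \<open>Commuting mixed second derivatives\<close>

lemma Ck_on_pred: "Ck_on (Suc k) S f \<Longrightarrow> Ck_on k S f"
proof (induction k arbitrary: f)
  case 0
  then show ?case
    by (auto intro: continuous_at_imp_continuous_on differentiable_imp_continuous_within)
qed auto

lemma has_real_derivative_along_line:
  fixes f :: "'a::real_normed_vector \<Rightarrow> real"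
  assumes "f differentiable (at (a + s *\<^sub>R u))"
  shows "((\<lambda>s. f (a + s *\<^sub>R u)) has_real_derivative
           frechet_derivative f (at (a + s *\<^sub>R u)) u) (at s)"
proof -
  have "((\<lambda>s. a + s *\<^sub>R u) has_vector_derivative u) (at s)"
    by (auto intro!: derivative_eq_intros)
  moreover have "(f has_derivative frechet_derivative f (at (a + s *\<^sub>R u))) (at (a + s *\<^sub>R u))"
    using assms frechet_derivative_works by blast
  ultimately have "((f \<circ> (\<lambda>s. a + s *\<^sub>R u)) has_vector_derivative
       frechet_derivative f (at (a + s *\<^sub>R u)) u) (at s)"
    by (intro vector_derivative_diff_chain_within) (auto intro: has_derivative_at_withinI)
  then show ?thesis
    by (simp add: has_real_derivative_iff_has_vector_derivative o_def)
qed

text \<open>The second difference is symmetric in \<open>u\<close> and \<open>v\<close>. Two applications of the mean value theorem,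
  first in the direction \<open>u\<close> and then in the direction \<open>v\<close>, turn it into a mixed derivative in one
  chosen order; exchanging \<open>u\<close> and \<open>v\<close> gives the other order.\<close>

lemma mixed_difference_mean_value:
  fixes f :: "'a::real_normed_vector \<Rightarrow> real"
  assumes h: "0 < h"
    and box: "\<And>s t. \<lbrakk>0 \<le> s; s \<le> h; 0 \<le> t; t \<le> h\<rbrakk> \<Longrightarrow> p + s *\<^sub>R u + t *\<^sub>R v \<in> S"
    and df: "\<And>x. x \<in> S \<Longrightarrow> f differentiable (at x)"
    and ddf: "\<And>x. x \<in> S \<Longrightarrow> (\<lambda>x. frechet_derivative f (at x) u) differentiable (at x)"
  obtains s t where "0 < s" "s < h" "0 < t" "t < h"
    "f (p + h *\<^sub>R u + h *\<^sub>R v) - f (p + h *\<^sub>R u) - f (p + h *\<^sub>R v) + f p =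
      h\<^sup>2 * frechet_derivative (\<lambda>x. frechet_derivative f (at x) u)
               (at (p + s *\<^sub>R u + t *\<^sub>R v)) v"
proof -
  let ?D = "\<lambda>x. frechet_derivative f (at x) u"
  let ?g = "\<lambda>s. f ((p + h *\<^sub>R v) + s *\<^sub>R u) - f (p + s *\<^sub>R u)"
  have "\<exists>s. 0 < s \<and> s < h \<and>
      ?g h - ?g 0 = (h - 0) * (?D ((p + h *\<^sub>R v) + s *\<^sub>R u) - ?D (p + s *\<^sub>R u))"
  proof (rule MVT2[OF h])
    fix s assume s: "0 \<le> s" "s \<le> h"
    have "(p + h *\<^sub>R v) + s *\<^sub>R u \<in> S" "p + s *\<^sub>R u \<in> S"
      using box[OF s, of h] box[OF s, of 0] h by (auto simp: algebra_simps)
    then show "DERIV ?g s :> ?D ((p + h *\<^sub>R v) + s *\<^sub>R u) - ?D (p + s *\<^sub>R u)"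
      by (intro DERIV_diff has_real_derivative_along_line df)
  qed
  then obtain s where s: "0 < s" "s < h"
    "?g h - ?g 0 = h * (?D ((p + h *\<^sub>R v) + s *\<^sub>R u) - ?D (p + s *\<^sub>R u))"
    by auto
  have "\<exists>t. 0 < t \<and> t < h \<and>
      ?D ((p + s *\<^sub>R u) + h *\<^sub>R v) - ?D ((p + s *\<^sub>R u) + 0 *\<^sub>R v) =
      (h - 0) * frechet_derivative ?D (at ((p + s *\<^sub>R u) + t *\<^sub>R v)) v"
    using s box h by (intro MVT2 has_real_derivative_along_line ddf) auto
  then obtain t where t: "0 < t" "t < h"
    "?D ((p + s *\<^sub>R u) + h *\<^sub>R v) - ?D (p + s *\<^sub>R u) =
      h * frechet_derivative ?D (at ((p + s *\<^sub>R u) + t *\<^sub>R v)) v"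
    by auto
  have "f (p + h *\<^sub>R u + h *\<^sub>R v) - f (p + h *\<^sub>R u) - f (p + h *\<^sub>R v) + f p = ?g h - ?g 0"
    by (simp add: algebra_simps)
  also have "\<dots> = h\<^sup>2 * frechet_derivative ?D (at (p + s *\<^sub>R u + t *\<^sub>R v)) v"
    using s(3) t(3) by (simp add: algebra_simps power2_eq_square)
  finally show thesis using that s t by blast
qed

text \<open>Both mixed derivatives take a common value, the scaled second difference, at points
  arbitrarily close to \<open>p\<close>; by continuity they agree at \<open>p\<close>.\<close>

lemma mixed_derivatives_commute:
  fixes f :: "'a::euclidean_space \<Rightarrow> real"
  assumes "open S" and C2: "Ck_on 2 S f" and "p \<in> S"
  shows "frechet_derivative (\<lambda>x. frechet_derivative f (at x) u) (at p) v =
         frechet_derivative (\<lambda>x. frechet_derivative f (at x) v) (at p) u"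
proof -
  define D2 where
    "D2 = (\<lambda>u v x. frechet_derivative (\<lambda>x. frechet_derivative f (at x) u) (at x) v)"
  have df: "f differentiable (at x)"
    and ddf: "(\<lambda>x. frechet_derivative f (at x) u) differentiable (at x)"
    and cont: "continuous_on S (D2 u v)" if "x \<in> S" for x u v
    using C2 that by (auto simp: numeral_2_eq_2 D2_def)
  have "\<bar>D2 u v p - D2 v u p\<bar> < e" if "e > 0" for e
  proof -
    have near: "\<exists>d>0. \<forall>x. dist x p < d \<longrightarrow> \<bar>D2 u v x - D2 u v p\<bar> < e / 2" for u v
    proof -
      have "isCont (D2 u v) p"
        using cont \<open>open S\<close> \<open>p \<in> S\<close> continuous_on_eq_continuous_at by blast
      then show ?thesis
        using \<open>e > 0\<close> unfolding continuous_at_eps_delta dist_real_def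
        by (metis half_gt_zero)
    qed
    obtain d1 where d1: "d1 > 0" "\<And>x. dist x p < d1 \<Longrightarrow> \<bar>D2 u v x - D2 u v p\<bar> < e / 2"
      using near by metis
    obtain d2 where d2: "d2 > 0" "\<And>x. dist x p < d2 \<Longrightarrow> \<bar>D2 v u x - D2 v u p\<bar> < e / 2"
      using near by metis
    obtain d3 where d3: "d3 > 0" "\<And>x. dist x p < d3 \<Longrightarrow> x \<in> S"
      using \<open>open S\<close> \<open>p \<in> S\<close> open_dist by metis
    define d where "d = min d1 (min d2 d3)"
    \<comment> \<open>The parallelogram with sides \<open>h u\<close>, \<open>h v\<close> at \<open>p\<close> must lie in the ball of radius \<open>d\<close>;
      the summand \<open>1\<close> covers \<open>u = v = 0\<close>.\<close>
    define h where "h = d / (2 * (norm u + norm v + 1))"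
    have "d > 0" using d1 d2 d3 by (simp add: d_def)
    have pos: "norm u + norm v + 1 > 0" by (smt (verit) norm_ge_zero)
    have "h > 0" using \<open>d > 0\<close> pos by (simp add: h_def)
    have small: "h * (norm u + norm v) < d"
    proof -
      have "h * (norm u + norm v) \<le> h * (norm u + norm v + 1)"
        using \<open>h > 0\<close> by (intro mult_left_mono) auto
      also have "\<dots> = d / 2"
        using pos by (simp add: h_def field_simps)
      finally show ?thesis using \<open>d > 0\<close> by simp
    qed
    have close: "dist (p + s *\<^sub>R u + t *\<^sub>R v) p < d"
      if "0 \<le> s" "s \<le> h" "0 \<le> t" "t \<le> h" for s t
    proof -
      have "norm (s *\<^sub>R u + t *\<^sub>R v) \<le> s * norm u + t * norm v"
        using that by (intro norm_triangle_le) auto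
      also have "\<dots> \<le> h * norm u + h * norm v"
        using that by (intro add_mono mult_right_mono) auto
      finally show ?thesis using small by (simp add: dist_norm algebra_simps)
    qed
    have box: "p + s *\<^sub>R u + t *\<^sub>R v \<in> S" "p + t *\<^sub>R v + s *\<^sub>R u \<in> S"
      if "0 \<le> s" "s \<le> h" "0 \<le> t" "t \<le> h" for s t
      using close[OF that] d3 by (auto simp: d_def algebra_simps)
    obtain s t where st: "0 < s" "s < h" "0 < t" "t < h"
      "f (p + h *\<^sub>R u + h *\<^sub>R v) - f (p + h *\<^sub>R u) - f (p + h *\<^sub>R v) + f p =
        h\<^sup>2 * D2 u v (p + s *\<^sub>R u + t *\<^sub>R v)"
      unfolding D2_def
      using mixed_difference_mean_value[where p = p and u = u and v = v and h = h and f = f and S = S]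
        \<open>h > 0\<close> box(1) df ddf by blast
    obtain s' t' where st': "0 < s'" "s' < h" "0 < t'" "t' < h"
      "f (p + h *\<^sub>R v + h *\<^sub>R u) - f (p + h *\<^sub>R v) - f (p + h *\<^sub>R u) + f p =
        h\<^sup>2 * D2 v u (p + s' *\<^sub>R v + t' *\<^sub>R u)"
      unfolding D2_def
      using mixed_difference_mean_value[where p = p and u = v and v = u and h = h and f = f and S = S]
        \<open>h > 0\<close> box(2) df ddf by blast
    have "h\<^sup>2 * D2 u v (p + s *\<^sub>R u + t *\<^sub>R v) = h\<^sup>2 * D2 v u (p + s' *\<^sub>R v + t' *\<^sub>R u)"
      using st(5) st'(5) by (simp add: algebra_simps)
    then have "D2 u v (p + s *\<^sub>R u + t *\<^sub>R v) = D2 v u (p + t' *\<^sub>R u + s' *\<^sub>R v)"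
      using \<open>h > 0\<close> by (simp add: algebra_simps)
    moreover have "\<bar>D2 u v (p + s *\<^sub>R u + t *\<^sub>R v) - D2 u v p\<bar> < e / 2"
      using close[of s t] st by (intro d1(2)) (simp add: d_def)
    moreover have "\<bar>D2 v u (p + t' *\<^sub>R u + s' *\<^sub>R v) - D2 v u p\<bar> < e / 2"
      using close[of t' s'] st' by (intro d2(2)) (simp add: d_def)
    ultimately show ?thesis by linarith
  qed
  then have "D2 u v p = D2 v u p"
    by (metis eq_iff_diff_eq_0 less_irrefl zero_less_abs_iff)
  then show ?thesis by (simp add: D2_def)
qed

section \<open>Gradient and Hessian as derivatives\<close>

lemma frechet_derivative_grad:
  assumes "f differentiable (at p)"
  shows "frechet_derivative f (at p) v = grad f p \<bullet> v"
proof -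
  have lin: "linear (frechet_derivative f (at p))"
    using assms by (rule linear_frechet_derivative)
  have "(\<Sum>i\<in>UNIV. (v $ i) *\<^sub>R axis i 1) = v"
    by (simp add: vec_eq_iff axis_def if_distrib cong: if_cong)
  then have "frechet_derivative f (at p) v =
      frechet_derivative f (at p) (\<Sum>i\<in>UNIV. (v $ i) *\<^sub>R axis i 1)"
    by simp
  also have "\<dots> = (\<Sum>i\<in>UNIV. (v $ i) *\<^sub>R frechet_derivative f (at p) (axis i 1))"
    by (simp add: linear_sum[OF lin] linear_cmul[OF lin])
  finally show ?thesis
    by (simp add: grad_def inner_vec_def mult.commute)
qed

lemma grad_has_derivative_hessian:
  assumes C2: "Ck_on 2 S f" and "p \<in> S"
  shows "(grad f has_derivative (\<lambda>u. hessian f p *v u)) (at p)"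
proof -
  have "(\<lambda>x. frechet_derivative f (at x) (axis i 1)) differentiable (at p)" for i
    using assms by (auto simp: numeral_2_eq_2)
  then have "(\<lambda>x. grad f x \<bullet> b) differentiable (at p)" if "b \<in> Basis" for b
    using that by (auto simp: Basis_vec_def grad_def inner_axis)
  then have "grad f differentiable (at p)"
    using differentiable_componentwise_within[of "grad f" p UNIV] by simp
  then show ?thesis
    unfolding hessian_def by (simp add: jacobian_works)
qed

lemma hessian_inner_symmetric:
  fixes f :: "real^'n \<Rightarrow> real"
  assumes "open S" and C2: "Ck_on 2 S f" and "p \<in> S"
  shows "(hessian f p *v u) \<bullet> v = (hessian f p *v v) \<bullet> u"
proof -
  have "frechet_derivative (\<lambda>x. frechet_derivative f (at x) v) (at p) u = (hessian f p *v u) \<bullet> v"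
    for u v
  proof -
    have "((\<lambda>x. grad f x \<bullet> v) has_derivative (\<lambda>u. (hessian f p *v u) \<bullet> v)) (at p)"
      using grad_has_derivative_hessian[OF C2 \<open>p \<in> S\<close>] by (auto intro!: derivative_eq_intros)
    moreover have "frechet_derivative f (at x) v = grad f x \<bullet> v" if "x \<in> S" for x
      using C2 that by (intro frechet_derivative_grad) (auto simp: numeral_2_eq_2)
    ultimately have "((\<lambda>x. frechet_derivative f (at x) v) has_derivative
        (\<lambda>u. (hessian f p *v u) \<bullet> v)) (at p)"
      using has_derivative_transform_within_open[OF _ \<open>open S\<close> \<open>p \<in> S\<close>] by force
    then show ?thesis by (simp add: frechet_derivative_at[symmetric])
  qed
  with mixed_derivatives_commute[OF assms] show ?thesis by metis
qed

lemma has_derivative_grad: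
  assumes "f differentiable (at p)"
  shows "(f has_derivative (\<lambda>v. grad f p \<bullet> v)) (at p)"
proof -
  have "frechet_derivative f (at p) = (\<lambda>v. grad f p \<bullet> v)"
    using frechet_derivative_grad[OF assms] by blast
  then show ?thesis
    using assms frechet_derivative_works by metis
qed

lemma grad_eqI:
  assumes "(f has_derivative (\<lambda>v. g \<bullet> v)) (at p)"
  shows "grad f p = g"
  using frechet_derivative_at[OF assms, symmetric]
  by (simp add: grad_def vec_eq_iff inner_axis)

lemma hessian_mult_eqI:
  assumes "(grad f has_derivative D) (at p)"
  shows "hessian f p *v u = D u"
proof -
  have "(grad f has_derivative (\<lambda>u. hessian f p *v u)) (at p)"
    unfolding hessian_def using assms jacobian_works differentiable_def by blast
  then have "(\<lambda>u. hessian f p *v u) = D"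
    using assms by (rule has_derivative_unique)
  then show ?thesis by metis
qed

section \<open>Homogeneity of the anisotropy\<close>

lemma anisotropy_C2: "anisotropy \<phi> \<Longrightarrow> Ck_on 2 (- {0}) \<phi>"
  using Ck_on_pred[of 3 "- {0}" \<phi>] Ck_on_pred[of 2 "- {0}" \<phi>]
  by (simp add: anisotropy_def del: Ck_on.simps)

lemma anisotropy_differentiable:
  "anisotropy \<phi> \<Longrightarrow> p \<noteq> 0 \<Longrightarrow> \<phi> differentiable (at p)"
  using anisotropy_C2[of \<phi>] by (auto simp: numeral_2_eq_2)

lemma anisotropy_hessian_symmetric:
  "anisotropy \<phi> \<Longrightarrow> p \<noteq> 0 \<Longrightarrow> (hessian \<phi> p *v u) \<bullet> v = (hessian \<phi> p *v v) \<bullet> u"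
  by (rule hessian_inner_symmetric[OF _ anisotropy_C2]) auto

lemma anisotropy_euler:
  assumes phi: "anisotropy \<phi>" and "p \<noteq> 0"
  shows "grad \<phi> p \<bullet> p = \<phi> p"
proof -
  have "((\<lambda>s. \<phi> (0 + s *\<^sub>R p)) has_real_derivative
          frechet_derivative \<phi> (at (0 + 1 *\<^sub>R p)) p) (at 1)"
    using anisotropy_differentiable[OF phi] \<open>p \<noteq> 0\<close>
    by (intro has_real_derivative_along_line) simp
  then have "((\<lambda>s. \<phi> (s *\<^sub>R p)) has_real_derivative grad \<phi> p \<bullet> p) (at 1)"
    using frechet_derivative_grad[OF anisotropy_differentiable[OF phi \<open>p \<noteq> 0\<close>]] by simp
  moreover have "((\<lambda>s. \<phi> (s *\<^sub>R p)) has_real_derivative \<phi> p) (at 1)"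
  proof (rule has_field_derivative_transform_within_open)
    show "((\<lambda>s. s * \<phi> p) has_real_derivative \<phi> p) (at 1)"
      by (auto intro!: derivative_eq_intros)
    show "s * \<phi> p = \<phi> (s *\<^sub>R p)" if "s \<in> {0<..}" for s
      using phi that by (simp add: anisotropy_def)
  qed auto
  ultimately show ?thesis by (rule DERIV_unique)
qed

text \<open>Differentiating Euler's identity gives only \<open>\<phi>''(p) u \<bullet> p = 0\<close> for all \<open>u\<close>, that is, \<open>p\<close> lies in
  the kernel of the transpose; symmetry of the Hessian moves it to the kernel itself.\<close>

lemma anisotropy_hessian_radial:
  assumes phi: "anisotropy \<phi>" and "p \<noteq> 0"
  shows "hessian \<phi> p *v p = 0"
proof -
  have "(hessian \<phi> p *v p) \<bullet> u = 0" for u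
  proof -
    have "((\<lambda>x. grad \<phi> x \<bullet> x) has_derivative
        (\<lambda>u. grad \<phi> p \<bullet> u + (hessian \<phi> p *v u) \<bullet> p)) (at p)"
      using grad_has_derivative_hessian[OF anisotropy_C2[OF phi]] \<open>p \<noteq> 0\<close>
      by (auto intro!: derivative_eq_intros)
    then have "(\<phi> has_derivative (\<lambda>u. grad \<phi> p \<bullet> u + (hessian \<phi> p *v u) \<bullet> p)) (at p)"
      by (rule has_derivative_transform_within_open[where s = "- {0}"])
        (use anisotropy_euler[OF phi] \<open>p \<noteq> 0\<close> in auto)
    then have "(\<lambda>u. grad \<phi> p \<bullet> u + (hessian \<phi> p *v u) \<bullet> p) = (\<lambda>u. grad \<phi> p \<bullet> u)"
      using has_derivative_grad[OF anisotropy_differentiable[OF phi \<open>p \<noteq> 0\<close>]]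
      by (rule has_derivative_unique)
    then have "(hessian \<phi> p *v u) \<bullet> p = 0"
      by (metis add_cancel_right_right)
    then show ?thesis
      using anisotropy_hessian_symmetric[OF phi \<open>p \<noteq> 0\<close>] by metis
  qed
  then show ?thesis using inner_eq_zero_iff by blast
qed

lemma anisotropy_grad_scale:
  assumes phi: "anisotropy \<phi>" and "p \<noteq> 0" and "c > 0"
  shows "grad \<phi> (c *\<^sub>R p) = grad \<phi> p"
proof -
  have scale: "(\<lambda>x. \<phi> (c *\<^sub>R x)) = (\<lambda>x. c * \<phi> x)"
    using phi \<open>c > 0\<close> by (simp add: anisotropy_def)
  have "(\<phi> has_derivative (\<lambda>v. grad \<phi> (c *\<^sub>R p) \<bullet> v)) (at (c *\<^sub>R p))"
    using assms by (intro has_derivative_grad anisotropy_differentiable) auto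
  then have "((\<lambda>x. \<phi> (c *\<^sub>R x)) has_derivative (\<lambda>v. grad \<phi> (c *\<^sub>R p) \<bullet> (c *\<^sub>R v))) (at p)"
    by (intro has_derivative_compose[where g = \<phi> and f = "\<lambda>x. c *\<^sub>R x"])
      (auto intro!: derivative_eq_intros)
  moreover have "((\<lambda>x. \<phi> (c *\<^sub>R x)) has_derivative (\<lambda>v. c * (grad \<phi> p \<bullet> v))) (at p)"
    unfolding scale using has_derivative_grad[OF anisotropy_differentiable[OF phi \<open>p \<noteq> 0\<close>]]
    by (auto intro!: derivative_eq_intros)
  ultimately have "(\<lambda>v. grad \<phi> (c *\<^sub>R p) \<bullet> (c *\<^sub>R v)) = (\<lambda>v. c * (grad \<phi> p \<bullet> v))"
    by (rule has_derivative_unique)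
  then have "grad \<phi> (c *\<^sub>R p) \<bullet> v = grad \<phi> p \<bullet> v" for v
    using \<open>c > 0\<close> by (auto dest: fun_cong[where x = v])
  then show ?thesis using vector_eq_rdot by blast
qed

text \<open>This \<open>(-1)\<close>-homogeneity reduces the positivity of \<open>\<phi>''(p)\<close> on the complement of \<open>p\<close> to the
  case \<open>|p| = 1\<close>, where the definition of an anisotropy provides it.\<close>

lemma anisotropy_hessian_scale:
  assumes phi: "anisotropy \<phi>" and "p \<noteq> 0" and "c > 0"
  shows "c *\<^sub>R (hessian \<phi> (c *\<^sub>R p) *v v) = hessian \<phi> p *v v"
proof -
  have "(grad \<phi> has_derivative (\<lambda>v. hessian \<phi> (c *\<^sub>R p) *v v)) (at (c *\<^sub>R p))"
    using assms by (intro grad_has_derivative_hessian[OF anisotropy_C2]) auto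
  then have "((\<lambda>x. grad \<phi> (c *\<^sub>R x)) has_derivative
      (\<lambda>v. hessian \<phi> (c *\<^sub>R p) *v (c *\<^sub>R v))) (at p)"
    by (intro has_derivative_compose[where g = "grad \<phi>" and f = "\<lambda>x. c *\<^sub>R x"])
      (auto intro!: derivative_eq_intros)
  then have "(grad \<phi> has_derivative (\<lambda>v. hessian \<phi> (c *\<^sub>R p) *v (c *\<^sub>R v))) (at p)"
    by (rule has_derivative_transform_within_open[where s = "- {0}"])
      (use anisotropy_grad_scale[OF phi] \<open>c > 0\<close> \<open>p \<noteq> 0\<close> in auto)
  from hessian_mult_eqI[OF this, of v] show ?thesis
    by (simp add: matrix_vector_mult_scaleR)
qed

lemma anisotropy_hessian_tangential_pos:
  assumes phi: "anisotropy \<phi>" and "p \<noteq> 0" "r \<noteq> 0" "p \<bullet> r = 0"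
  shows "(hessian \<phi> p *v r) \<bullet> r > 0"
proof -
  have scale: "hessian \<phi> p *v r = (1 / norm p) *\<^sub>R (hessian \<phi> (sgn p) *v r)"
    using anisotropy_hessian_scale[OF phi \<open>p \<noteq> 0\<close>, of "1 / norm p" r] \<open>p \<noteq> 0\<close>
    by (simp add: sgn_div_norm divide_inverse)
  define k e where "k = norm r" and "e = sgn r"
  have "r = k *\<^sub>R e"
    using \<open>r \<noteq> 0\<close> by (simp add: sgn_div_norm k_def e_def)
  then have "(hessian \<phi> p *v r) \<bullet> r = k\<^sup>2 / norm p * ((hessian \<phi> (sgn p) *v e) \<bullet> e)"
    unfolding scale by (simp add: matrix_vector_mult_scaleR power2_eq_square)
  then have "(hessian \<phi> p *v r) \<bullet> r =
      (norm r)\<^sup>2 / norm p * ((hessian \<phi> (sgn p) *v sgn r) \<bullet> sgn r)"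
    by (simp only: k_def e_def)
  moreover have "(hessian \<phi> (sgn p) *v sgn r) \<bullet> sgn r > 0"
  proof -
    have "norm (sgn p) = 1" "norm (sgn r) = 1" "sgn p \<bullet> sgn r = 0"
      using assms(2-) by (auto simp: norm_sgn sgn_div_norm)
    then show ?thesis using phi unfolding anisotropy_def by blast
  qed
  ultimately show ?thesis
    using \<open>p \<noteq> 0\<close> \<open>r \<noteq> 0\<close> by simp
qed

section \<open>The Hessian of \<open>\<Phi>\<close>\<close>

lemma grad_Phi:
  assumes phi: "anisotropy \<phi>" and "p \<noteq> 0"
  shows "grad (Phi \<phi>) p = \<phi> p *\<^sub>R grad \<phi> p"
proof (rule grad_eqI)
  show "(Phi \<phi> has_derivative (\<lambda>v. (\<phi> p *\<^sub>R grad \<phi> p) \<bullet> v)) (at p)"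
    unfolding Phi_def[abs_def]
    using has_derivative_grad[OF anisotropy_differentiable[OF phi \<open>p \<noteq> 0\<close>]]
    by (auto intro!: derivative_eq_intros)
qed

lemma grad_Phi_has_derivative:
  assumes phi: "anisotropy \<phi>" and "p \<noteq> 0"
  shows "(grad (Phi \<phi>) has_derivative
           (\<lambda>u. \<phi> p *\<^sub>R (hessian \<phi> p *v u) + (grad \<phi> p \<bullet> u) *\<^sub>R grad \<phi> p)) (at p)"
proof -
  have "((\<lambda>x. \<phi> x *\<^sub>R grad \<phi> x) has_derivative
      (\<lambda>u. \<phi> p *\<^sub>R (hessian \<phi> p *v u) + (grad \<phi> p \<bullet> u) *\<^sub>R grad \<phi> p)) (at p)"
    using grad_has_derivative_hessian[OF anisotropy_C2[OF phi]] \<open>p \<noteq> 0\<close>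
      has_derivative_grad[OF anisotropy_differentiable[OF phi \<open>p \<noteq> 0\<close>]]
    by (intro has_derivative_scaleR) auto
  then show ?thesis
    by (rule has_derivative_transform_within_open[where s = "- {0}"])
      (use grad_Phi[OF phi] \<open>p \<noteq> 0\<close> in auto)
qed

lemmas hessian_Phi_mult = hessian_mult_eqI[OF grad_Phi_has_derivative]

lemma hessian_Phi_symmetric:
  assumes "anisotropy \<phi>" and "p \<noteq> 0"
  shows "(hessian (Phi \<phi>) p *v u) \<bullet> v = (hessian (Phi \<phi>) p *v v) \<bullet> u"
  using anisotropy_hessian_symmetric[OF assms, of u v]
  by (simp add: hessian_Phi_mult[OF assms] inner_add_left)

text \<open>With \<open>q = r + c p\<close> and \<open>r\<close> orthogonal to \<open>p\<close>, the form equals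
  \<open>\<phi> (\<phi>'' r \<bullet> r) + (\<phi>' \<bullet> q)\<^sup>2\<close>. The first term is positive unless \<open>r = 0\<close>, and then the second
  one is \<open>(c \<phi>(p))\<^sup>2 > 0\<close>.\<close>

lemma hessian_Phi_pos:
  assumes phi: "anisotropy \<phi>" and "p \<noteq> 0" and "q \<noteq> 0"
  shows "(hessian (Phi \<phi>) p *v q) \<bullet> q > 0"
proof -
  define c where "c = (p \<bullet> q) / (p \<bullet> p)"
  define r where "r = q - c *\<^sub>R p"
  have "\<phi> p > 0" using phi \<open>p \<noteq> 0\<close> by (simp add: anisotropy_def)
  have q: "q = r + c *\<^sub>R p" and perp: "p \<bullet> r = 0"
    using \<open>p \<noteq> 0\<close> by (auto simp: r_def c_def inner_diff_right)
  have Hq: "hessian \<phi> p *v q = hessian \<phi> p *v r"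
    by (simp add: q matrix_vector_right_distrib matrix_vector_mult_scaleR
        anisotropy_hessian_radial[OF phi \<open>p \<noteq> 0\<close>])
  have "(hessian \<phi> p *v r) \<bullet> q = (hessian \<phi> p *v r) \<bullet> r"
    using anisotropy_hessian_symmetric[OF phi \<open>p \<noteq> 0\<close>] Hq by metis
  then have form: "(hessian (Phi \<phi>) p *v q) \<bullet> q =
      \<phi> p * ((hessian \<phi> p *v r) \<bullet> r) + (grad \<phi> p \<bullet> q)\<^sup>2"
    by (simp add: hessian_Phi_mult[OF phi \<open>p \<noteq> 0\<close>] Hq inner_add_left power2_eq_square)
  show ?thesis
  proof (cases "r = 0")
    case True
    then have "grad \<phi> p \<bullet> q = c * \<phi> p" "c \<noteq> 0"
      using anisotropy_euler[OF phi \<open>p \<noteq> 0\<close>] \<open>q \<noteq> 0\<close> q by auto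
    then show ?thesis using True \<open>\<phi> p > 0\<close> by (simp add: form)
  next
    case False
    then show ?thesis
      using anisotropy_hessian_tangential_pos[OF phi \<open>p \<noteq> 0\<close> _ perp] \<open>\<phi> p > 0\<close>
      by (simp add: form add_pos_nonneg)
  qed
qed

section \<open>Positivity of the matrix \<open>H\<close>\<close>

lemma outer_mult_vec: "(a \<otimes>\<^sub>o b) *v u = (b \<bullet> u) *\<^sub>R a"
  by (simp add: outer_def matrix_vector_mult_def inner_vec_def vec_eq_iff sum_distrib_left
      ac_simps)

lemma wvec_orthogonal:
  assumes phi: "anisotropy \<phi>" and "p \<noteq> 0"
  shows "wvec \<phi> p \<bullet> sgn p = 0"
proof -
  have "\<phi> p > 0" using phi \<open>p \<noteq> 0\<close> by (simp add: anisotropy_def)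
  have "wvec \<phi> p \<bullet> p = 0"
    using anisotropy_euler[OF assms] \<open>p \<noteq> 0\<close> \<open>\<phi> p > 0\<close>
    by (simp add: wvec_def inner_diff_left sgn_div_norm dot_square_norm power2_eq_square)
  then show ?thesis by (simp add: sgn_div_norm)
qed

text \<open>Although \<open>H\<close> need not be symmetric, the mixed terms of its quadratic form cancel. The
  rest of the correction costs at most the fraction \<open>|w|\<^sup>2 / (1 + |w|\<^sup>2) < 1\<close> of \<open>|u|\<^sup>2\<close>.\<close>

lemma Hmat_pos:
  assumes phi: "anisotropy \<phi>" and mob: "mobility m" and "p \<noteq> 0" and "u \<noteq> 0"
  shows "(Hmat \<phi> m p *v u) \<bullet> u > 0"
proof -
  define w \<tau> where "w = wvec \<phi> p" and "\<tau> = sgn p"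
  define W s where "W = (norm w)\<^sup>2" and "s = \<tau> \<bullet> u"
  have w_perp: "w \<bullet> \<tau> = 0" using wvec_orthogonal[OF assms(1,3)] by (simp add: w_def \<tau>_def)
  have unit: "\<tau> \<bullet> \<tau> = 1" using \<open>p \<noteq> 0\<close> by (simp add: \<tau>_def dot_square_norm norm_sgn)
  have "W \<ge> 0" by (simp add: W_def)
  have "alpha \<phi> m p > 0"
    using phi mob \<open>p \<noteq> 0\<close>
    by (simp add: alpha_def ext0_def anisotropy_def mobility_def norm_sgn)
  have form: "(Hmat \<phi> m p *v u) \<bullet> u =
      alpha \<phi> m p * (u \<bullet> u - ((w \<bullet> u)\<^sup>2 + W * s\<^sup>2) / (1 + W))"
  proof -
    have "(Hmat \<phi> m p *v u) \<bullet> u = alpha \<phi> m p * (u \<bullet> u + 1 / (1 + W) *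
        (((\<tau> - w) \<bullet> u) * (w \<bullet> u) - ((w + W *\<^sub>R \<tau>) \<bullet> u) * (\<tau> \<bullet> u)))"
      by (simp add: Hmat_def Let_def w_def[symmetric] \<tau>_def[symmetric] W_def[symmetric]
          scaleR_matrix_vector_assoc[symmetric] matrix_vector_mult_add_rdistrib
          matrix_vector_mult_diff_rdistrib outer_mult_vec inner_add_left inner_diff_left)
    also have "((\<tau> - w) \<bullet> u) * (w \<bullet> u) - ((w + W *\<^sub>R \<tau>) \<bullet> u) * (\<tau> \<bullet> u) =
        - ((w \<bullet> u)\<^sup>2 + W * s\<^sup>2)"
      by (simp add: s_def inner_add_left inner_diff_left power2_eq_square algebra_simps)
    finally show ?thesis by (simp add: minus_divide_left)
  qed
  \<comment> \<open>Only the part of \<open>u\<close> orthogonal to \<open>\<tau>\<close> meets \<open>w\<close>. Applying Cauchy-Schwarz to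
    that part leaves room for \<open>W * s\<^sup>2\<close>.\<close>
  have "(w \<bullet> u)\<^sup>2 = (w \<bullet> (u - s *\<^sub>R \<tau>))\<^sup>2"
    by (simp add: inner_diff_right w_perp)
  also have "\<dots> \<le> (w \<bullet> w) * ((u - s *\<^sub>R \<tau>) \<bullet> (u - s *\<^sub>R \<tau>))"
    by (rule Cauchy_Schwarz_ineq)
  also have "\<dots> = W * (u \<bullet> u - s\<^sup>2)"
  proof -
    have "(u - s *\<^sub>R \<tau>) \<bullet> (u - s *\<^sub>R \<tau>) = u \<bullet> u - s\<^sup>2"
      by (simp add: s_def inner_diff_left inner_diff_right inner_commute[of u \<tau>] unit
          power2_eq_square)
    then show ?thesis by (simp add: W_def dot_square_norm)
  qed
  finally have "(w \<bullet> u)\<^sup>2 + W * s\<^sup>2 \<le> W * (u \<bullet> u)"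
    by (simp add: algebra_simps)
  also have "\<dots> < (1 + W) * (u \<bullet> u)"
    using \<open>u \<noteq> 0\<close> by (simp add: distrib_right)
  finally have "((w \<bullet> u)\<^sup>2 + W * s\<^sup>2) / (1 + W) < u \<bullet> u"
    using \<open>W \<ge> 0\<close> by (simp add: field_simps)
  then show ?thesis
    using \<open>alpha \<phi> m p > 0\<close> by (simp add: form)
qed

section \<open>Eigenvalues and invertibility\<close>

lemma positive_definite_matrix_inv:
  fixes H :: "real^'n^'n"
  assumes "\<And>u. u \<noteq> 0 \<Longrightarrow> (H *v u) \<bullet> u > 0"
  shows "H ** matrix_inv H = mat 1 \<and> matrix_inv H ** H = mat 1"
proof -
  have "\<forall>u. H *v u = 0 \<longrightarrow> u = 0"
    using assms by (metis inner_zero_left less_irrefl)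
  then have "\<exists>B. H ** B = mat 1 \<and> B ** H = mat 1"
    using matrix_left_invertible_ker[of H] invertible_left_inverse[of H]
    unfolding invertible_def by blast
  then show ?thesis
    unfolding matrix_inv_def by (rule someI_ex)
qed

text \<open>Write \<open>v = a + \<i> b\<close> for an eigenvector. The real and imaginary parts of \<open>v\<^sup>*S v = \<mu> v\<^sup>*H v\<close> with
  \<open>v\<^sup>*H v = P - \<i> Q\<close> read \<open>0 < Re \<mu> P + Im \<mu> Q\<close> and \<open>0 = Im \<mu> P - Re \<mu> Q\<close>; the second uses the
  symmetry of \<open>S\<close>. Eliminating \<open>Im \<mu>\<close> gives \<open>0 < Re \<mu> (P\<^sup>2 + Q\<^sup>2)\<close>, since \<open>P > 0\<close>.\<close>

lemma eigenvalue_pos_real_part: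
  fixes H S :: "real^'n^'n"
  assumes H_pos: "\<And>u. u \<noteq> 0 \<Longrightarrow> (H *v u) \<bullet> u > 0"
    and S_pos: "\<And>u. u \<noteq> 0 \<Longrightarrow> (S *v u) \<bullet> u > 0"
    and S_sym: "\<And>u v. (S *v u) \<bullet> v = (S *v v) \<bullet> u"
    and ev: "is_eigenvalue (map_matrix complex_of_real (matrix_inv H ** S)) \<mu>"
  shows "Re \<mu> > 0"
proof -
  define K where "K = matrix_inv H ** S"
  have HK: "H *v (K *v x) = S *v x" for x
    using positive_definite_matrix_inv[OF H_pos]
    by (simp add: K_def matrix_vector_mul_assoc matrix_mul_assoc)
  obtain v where "v \<noteq> 0" and v: "map_matrix complex_of_real K *v v = \<mu> *s v"
    using ev by (auto simp: is_eigenvalue_def K_def)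
  define a b where "a = (\<chi> i. Re (v $ i))" and "b = (\<chi> i. Im (v $ i))"
  have entry: "(\<Sum>j\<in>UNIV. complex_of_real (K $ i $ j) * v $ j) = \<mu> * v $ i" for i
    using v by (simp add: vec_eq_iff matrix_vector_mult_def)
  have "K *v a = Re \<mu> *\<^sub>R a - Im \<mu> *\<^sub>R b"
    using arg_cong[OF entry, of Re] by (simp add: vec_eq_iff matrix_vector_mult_def a_def b_def)
  then have Sa: "S *v a = Re \<mu> *\<^sub>R (H *v a) - Im \<mu> *\<^sub>R (H *v b)"
    using HK[of a] by (simp add: matrix_vector_mult_diff_distrib matrix_vector_mult_scaleR)
  have "K *v b = Re \<mu> *\<^sub>R b + Im \<mu> *\<^sub>R a"
    using arg_cong[OF entry, of Im] by (simp add: vec_eq_iff matrix_vector_mult_def a_def b_def)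
  then have Sb: "S *v b = Re \<mu> *\<^sub>R (H *v b) + Im \<mu> *\<^sub>R (H *v a)"
    using HK[of b] by (simp add: matrix_vector_right_distrib matrix_vector_mult_scaleR)
  define P Q where "P = (H *v a) \<bullet> a + (H *v b) \<bullet> b" and "Q = (H *v a) \<bullet> b - (H *v b) \<bullet> a"
  have nz: "a \<noteq> 0 \<or> b \<noteq> 0"
    using \<open>v \<noteq> 0\<close> by (auto simp: vec_eq_iff a_def b_def complex_eq_iff)
  have sum_pos: "(M *v a) \<bullet> a + (M *v b) \<bullet> b > 0"
    if "\<And>u. u \<noteq> 0 \<Longrightarrow> (M *v u) \<bullet> u > 0" for M :: "real^'n^'n"
    using nz that[of a] that[of b] by (cases "a = 0"; cases "b = 0") (auto simp: add_pos_pos)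
  have "P > 0" unfolding P_def by (rule sum_pos) (rule H_pos)
  have "0 < (S *v a) \<bullet> a + (S *v b) \<bullet> b" by (rule sum_pos) (rule S_pos)
  also have "\<dots> = Re \<mu> * P + Im \<mu> * Q"
    by (simp add: Sa Sb P_def Q_def inner_add_left inner_diff_left algebra_simps)
  finally have real_part: "0 < Re \<mu> * P + Im \<mu> * Q" .
  have "0 = (S *v a) \<bullet> b - (S *v b) \<bullet> a" using S_sym by simp
  also have "\<dots> = Re \<mu> * Q - Im \<mu> * P"
    by (simp add: Sa Sb P_def Q_def inner_add_left inner_diff_left algebra_simps)
  finally have imag_part: "Im \<mu> * P = Re \<mu> * Q" by simp
  have "0 < P * (Re \<mu> * P + Im \<mu> * Q)"
    using \<open>P > 0\<close> real_part by simp
  also have "\<dots> = Re \<mu> * P\<^sup>2 + (Im \<mu> * P) * Q"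
    by (simp add: algebra_simps power2_eq_square)
  also have "\<dots> = Re \<mu> * (P\<^sup>2 + Q\<^sup>2)"
    unfolding imag_part by (simp add: algebra_simps power2_eq_square)
  finally show ?thesis
    using zero_less_mult_pos2[of "Re \<mu>" "P\<^sup>2 + Q\<^sup>2"] \<open>P > 0\<close> by (simp add: add_pos_nonneg)
qed

section \<open>The quasilinear form of the system and its parabolicity\<close>

lemma D_rho_grad_Phi:
  assumes phi: "anisotropy \<phi>" and "D_rho x \<rho> t \<noteq> 0"
    and "(\<lambda>\<sigma>. D_rho x \<sigma> t) differentiable (at \<rho>)"
  shows "D_rho (\<lambda>\<sigma> s. grad (Phi \<phi>) (D_rho x \<sigma> s)) \<rho> t =
           hessian (Phi \<phi>) (D_rho x \<rho> t) *v D_rho (D_rho x) \<rho> t"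
proof -
  let ?p = "D_rho x \<rho> t"
  have "((\<lambda>\<sigma>. D_rho x \<sigma> t) has_vector_derivative D_rho (D_rho x) \<rho> t) (at \<rho>)"
    unfolding D_rho_def[of "D_rho x"] using assms(3) vector_derivative_works by blast
  moreover have "(grad (Phi \<phi>) has_derivative (\<lambda>u. hessian (Phi \<phi>) ?p *v u)) (at ?p)"
    using grad_Phi_has_derivative[OF assms(1,2)] hessian_Phi_mult[OF assms(1,2)] by simp
  ultimately have "(grad (Phi \<phi>) \<circ> (\<lambda>\<sigma>. D_rho x \<sigma> t) has_vector_derivative
      hessian (Phi \<phi>) ?p *v D_rho (D_rho x) \<rho> t) (at \<rho>)"
    by (intro vector_derivative_diff_chain_within) (auto intro: has_derivative_at_withinI)
  then show ?thesis
    unfolding D_rho_def[of "\<lambda>\<sigma> s. grad (Phi \<phi>) (D_rho x \<sigma> s)"]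
    by (simp add: vector_derivative_at o_def)
qed

theorem lemma2p4:
  fixes \<phi> m :: "real^'n \<Rightarrow> real"
  assumes dim: "CARD('n) \<ge> 2"
    and phi: "anisotropy \<phi>"
    and mob: "mobility m"
  defines "A \<equiv> (\<lambda>p. matrix_inv (Hmat \<phi> m p) ** hessian (Phi \<phi>) p)"
  shows "(\<forall>T x. regular_family T x \<longrightarrow>
            (\<forall>t\<in>{0<..T}. \<forall>\<rho>.
               flow_equation_at \<phi> m T x \<rho> t \<longleftrightarrow> quasilinear_equation_at A T x \<rho> t))
         \<and> petrovsky_parabolic A"
proof
  show "petrovsky_parabolic A"
    unfolding petrovsky_parabolic_def A_def
    using eigenvalue_pos_real_part[OF Hmat_pos[OF phi mob] hessian_Phi_pos[OF phi]
        hessian_Phi_symmetric[OF phi]] by blast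
  show "\<forall>T x. regular_family T x \<longrightarrow> (\<forall>t\<in>{0<..T}. \<forall>\<rho>.
      flow_equation_at \<phi> m T x \<rho> t \<longleftrightarrow> quasilinear_equation_at A T x \<rho> t)"
  proof (intro allI impI ballI)
    fix T t \<rho> :: real and x :: "real \<Rightarrow> real \<Rightarrow> real^'n"
    assume "regular_family T x" and t: "t \<in> {0<..T}"
    then have p: "D_rho x \<rho> t \<noteq> 0" and diff: "(\<lambda>\<sigma>. D_rho x \<sigma> t) differentiable (at \<rho>)"
      by (auto simp: regular_family_def)
    let ?H = "Hmat \<phi> m (D_rho x \<rho> t)"
    have "?H ** matrix_inv ?H = mat 1 \<and> matrix_inv ?H ** ?H = mat 1"
      by (rule positive_definite_matrix_inv) (rule Hmat_pos[OF phi mob p])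
    then have "?H *v y = z \<longleftrightarrow> y = matrix_inv ?H *v z" for y z
      by (metis matrix_vector_mul_assoc matrix_vector_mul_lid)
    then show "flow_equation_at \<phi> m T x \<rho> t \<longleftrightarrow> quasilinear_equation_at A T x \<rho> t"
      unfolding flow_equation_at_def quasilinear_equation_at_def A_def
      by (simp add: D_rho_grad_Phi[OF phi p diff] matrix_vector_mul_assoc)
  qed
qed

end
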